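(* For every integer $m\ge1$, $$\mathcal{J}^m(0)=\frac12\sum_{k=1}^m\binom{m}{k}(-1)^{k+1}\mathcal{J}^{m-k}(k),$$ where $\mathcal{J}^m(0)$ denotes the regularized (Abel) value $\lim_{x\to1^-}\sum_{n\ge1}(-1)^{n+1}H_n^m x^n$, i.e. the value at $s=0$ of the continuation of $\mathcal{J}^m(s)$.
   Context: $H_n=1+\frac12+\cdots+\frac1n$. For integers $j\ge0$, $\mathcal{J}^j(s)=\sum_{n\ge1}(-1)^{n+1}H_n^j n^{-s}$ (convergent for $\Re(s)>0$); in particular $\mathcal{J}^0(s)=\eta(s)=\sum_{n\ge1}(-1)^{n+1}n^{-s}$ is the Dirichlet eta function. On the right-hand side $k\ge1$, so all values $\mathcal{J}^{m-k}(k)$ are given by convergent series. *)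

theory Defs
  imports "HOL-Complex_Analysis.Complex_Analysis"
begin

(* The n-th summand below is the mathematical summand of index Suc n, so that
   (-1)^n here is the sign (-1)^(n+1) of a series starting at index 1. *)

definition harm_eta :: "nat \<Rightarrow> complex \<Rightarrow> complex" where
  "harm_eta j s = (\<Sum>n. (-1) ^ n * harm (Suc n) ^ j * of_nat (Suc n) powr (- s))"

definition harm_eta_abel :: "nat \<Rightarrow> real \<Rightarrow> complex" where
  "harm_eta_abel j x = (\<Sum>n. (-1) ^ n * harm (Suc n) ^ j * of_real x ^ Suc n)"

(* v is the regularized value at 0: the limit in the first conjunct, which is also the
   value at 0 of the analytic continuation. By the identity theorem a continuation to
   the half-plane Re s > -1 is unique and agrees with one to the whole plane. *)
definition harm_eta_regularized_at_0 :: "nat \<Rightarrow> complex \<Rightarrow> bool" where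
  "harm_eta_regularized_at_0 j v \<longleftrightarrow>
     (harm_eta_abel j \<longlongrightarrow> v) (at_left 1) \<and>
     (\<exists>F. F holomorphic_on {s. Re s > -1} \<and>
          (\<forall>s. Re s > 0 \<longrightarrow> F s = harm_eta j s) \<and> F 0 = v)"

end

theory Submission
  imports Defs
begin

text \<open>
  Put \<open>f n = H\<^sub>n\<^sub>+\<^sub>1\<^sup>m (n + 1)\<^sup>-\<^sup>s\<close>. Whenever \<open>f\<close> tends to 0, the alternating sum of \<open>f\<close> is half of \<open>f 0\<close> plus
  the alternating sum of the differences \<open>f n - f (n + 1)\<close>, and multiplication by \<open>1 + x\<close> gives the
  same rule for Abel sums. Applying the rule twice leaves the second differences of \<open>f\<close>, which
  are \<open>O(n\<^sup>a\<^sup>-\<^sup>2)\<close> for every \<open>a > - Re s\<close>, so that for \<open>Re s > -1\<close> the resulting series converges absolutely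
  and locally uniformly: it is the analytic continuation, and at \<open>s = 0\<close> it is also the Abel limit.
  Applying the rule only once at \<open>s = 0\<close> produces the differences \<open>H\<^sub>n\<^sup>m - (H\<^sub>n - 1/n)\<^sup>m\<close>, whose
  binomial expansion is the claimed formula.
\<close>

section \<open>Summation by parts for alternating series and their Abel sums\<close>

definition bdiff :: "(nat \<Rightarrow> 'a::ab_group_add) \<Rightarrow> nat \<Rightarrow> 'a" where
  "bdiff f n = f n - f (Suc n)"

text \<open>Two steps of Euler's transformation of the alternating sum of \<open>f\<close>. Only the
  second differences have to be summable for this value to be meaningful, so it also covers
  divergent series.\<close>

definition euler_value :: "(nat \<Rightarrow> complex) \<Rightarrow> complex" where
  "euler_value f = (f 0 + (bdiff f 0 + (\<Sum>n. (-1) ^ n * bdiff (bdiff f) n)) / 2) / 2"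

lemma bdiff_mult:
  fixes f g :: "nat \<Rightarrow> 'a::comm_ring"
  shows "bdiff (\<lambda>n. f n * g n) n = bdiff f n * g n + f (Suc n) * bdiff g n"
  by (simp add: bdiff_def algebra_simps)

lemma bdiff2_mult:
  fixes f g :: "nat \<Rightarrow> 'a::comm_ring_1"
  shows "bdiff (bdiff (\<lambda>n. f n * g n)) n =
    bdiff (bdiff f) n * g n + 2 * (bdiff f (Suc n) * bdiff g n)
      + f (Suc (Suc n)) * bdiff (bdiff g) n"
  by (simp add: bdiff_def algebra_simps)

text \<open>The rule holds for partial sums up to the boundary term \<open>(-1) ^ N * f N\<close>,
  which vanishes in the limit because \<open>f\<close> tends to 0.\<close>

lemma alternating_sums_bdiff:
  fixes f :: "nat \<Rightarrow> complex"
  assumes "f \<longlonglongrightarrow> 0" and "(\<lambda>n. (-1) ^ n * bdiff f n) sums L"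
  shows "(\<lambda>n. (-1) ^ n * f n) sums ((f 0 + L) / 2)"
proof -
  have eq: "(\<Sum>n<N. (-1) ^ n * f n) =
      (f 0 + (\<Sum>n<N. (-1) ^ n * bdiff f n) - (-1) ^ N * f N) / 2" for N
    by (induction N) (simp_all add: bdiff_def field_simps)
  have "(\<lambda>N. (-1) ^ N * f N) \<longlonglongrightarrow> 0"
    using tendsto_norm_zero[OF assms(1)]
    by (intro tendsto_norm_zero_cancel[where f = "\<lambda>N. (-1) ^ N * f N"]) (simp add: norm_mult norm_power)
  then have "(\<lambda>N. (f 0 + (\<Sum>n<N. (-1) ^ n * bdiff f n) - (-1) ^ N * f N) / 2)
      \<longlonglongrightarrow> (f 0 + L - 0) / 2"
    using assms(2) unfolding sums_def by (intro tendsto_intros) auto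
  then show ?thesis by (simp add: sums_def eq)
qed

lemma summable_linear_growth_power:
  fixes f :: "nat \<Rightarrow> complex"
  assumes "\<And>n. norm (f n) \<le> C * (real n + 1)" and "norm z < 1"
  shows "summable (\<lambda>n. f n * z ^ n)"
proof (rule summable_comparison_test')
  show "summable (\<lambda>n. C * (of_nat (Suc n) * norm z ^ n))"
    using geometric_deriv_sums[of "norm z"] assms(2)
    by (intro summable_mult) (auto simp: sums_iff)
  show "norm (f n * z ^ n) \<le> C * (of_nat (Suc n) * norm z ^ n)" for n
    using mult_right_mono[OF assms(1)[of n], of "norm z ^ n"]
    by (simp add: norm_mult norm_power algebra_simps)
qed

text \<open>With A and D the power series of \<open>f\<close> and of its differences, comparing
  coefficients gives \<open>(1 + x) * A x = f 0 + x * D x\<close>, and x tends to 1. Linear growth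
  of \<open>f\<close> secures convergence for \<open>0 < x < 1\<close>.\<close>

lemma alternating_abel_bdiff:
  fixes f :: "nat \<Rightarrow> complex"
  assumes bnd: "\<And>n. norm (f n) \<le> C * (real n + 1)"
    and lim: "((\<lambda>x. \<Sum>n. (-1) ^ n * bdiff f n * of_real x ^ n) \<longlongrightarrow> L) (at_left 1)"
  shows "((\<lambda>x. \<Sum>n. (-1) ^ n * f n * of_real x ^ n) \<longlongrightarrow> (f 0 + L) / 2) (at_left 1)"
proof -
  have ev: "\<forall>\<^sub>F x in at_left (1::real). 0 < x \<and> x < 1"
    using eventually_at_left_real[of 0 1] by simp
  have "(f 0 + of_real x * (\<Sum>n. (-1) ^ n * bdiff f n * of_real x ^ n)) / (1 + of_real x) =
      (\<Sum>n. (-1) ^ n * f n * of_real x ^ n)"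
    if x: "0 < x" "x < 1" for x :: real
  proof -
    let ?z = "of_real x :: complex" and ?a = "\<lambda>n. (-1) ^ n * f n * of_real x ^ n"
    have "summable ?a"
      by (rule summable_linear_growth_power) (use x bnd in \<open>auto simp: norm_mult norm_power\<close>)
    then have s: "?a sums suminf ?a" by (rule summable_sums)
    from s have s': "(\<lambda>n. ?a (Suc n)) sums (suminf ?a - ?a 0)"
      by (subst sums_Suc_iff) simp
    have "(\<lambda>n. ?z * ?a n + ?a (Suc n)) sums (?z * suminf ?a + (suminf ?a - ?a 0))"
      by (intro sums_add sums_mult s s')
    also have "(\<lambda>n. ?z * ?a n + ?a (Suc n)) = (\<lambda>n. ?z * ((-1) ^ n * bdiff f n * ?z ^ n))"
      by (simp add: bdiff_def algebra_simps)
    finally have "(\<lambda>n. ?z * ((-1) ^ n * bdiff f n * ?z ^ n)) sums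
        (?z * suminf ?a + (suminf ?a - ?a 0))" .
    \<comment> \<open>Dividing by the nonzero \<open>?z\<close> also shows that the difference
      series converges, so its \<open>suminf\<close> is a genuine sum.\<close>
    from sums_divide[OF this, of ?z]
    have "?z * (\<Sum>n. (-1) ^ n * bdiff f n * ?z ^ n) = ?z * suminf ?a + (suminf ?a - f 0)"
      using x by (simp add: sums_iff)
    moreover have "1 + ?z \<noteq> 0"
      using x by (simp add: complex_eq_iff)
    ultimately show ?thesis by (simp add: field_simps)
  qed
  then have eq: "\<forall>\<^sub>F x in at_left (1::real).
      (f 0 + of_real x * (\<Sum>n. (-1) ^ n * bdiff f n * of_real x ^ n)) / (1 + of_real x) =
      (\<Sum>n. (-1) ^ n * f n * of_real x ^ n)"
    using ev by (auto elim: eventually_mono)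
  have "((\<lambda>x. (f 0 + of_real x * (\<Sum>n. (-1) ^ n * bdiff f n * of_real x ^ n)) / (1 + of_real x))
      \<longlongrightarrow> (f 0 + of_real 1 * L) / (1 + of_real 1)) (at_left (1::real))"
    by (intro tendsto_intros lim) auto
  then show ?thesis
    using tendsto_cong[OF eq] by simp
qed

text \<open>Absolute convergence at 1 makes the power series converge uniformly on [0, 1], so its
  sum is continuous up to the endpoint.\<close>

lemma abel_limit_absolutely_convergent:
  fixes c :: "nat \<Rightarrow> complex"
  assumes "summable (\<lambda>n. norm (c n))"
  shows "((\<lambda>x. \<Sum>n. c n * of_real x ^ n) \<longlongrightarrow> suminf c) (at_left (1::real))"
proof -
  have "uniform_limit {0..1::real} (\<lambda>N x. \<Sum>n<N. c n * of_real x ^ n)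
      (\<lambda>x. \<Sum>n. c n * of_real x ^ n) sequentially"
    by (rule Weierstrass_m_test[OF _ assms])
      (auto simp: norm_mult norm_power mult_left_le power_le_one)
  then have "continuous_on {0..1::real} (\<lambda>x. \<Sum>n. c n * of_real x ^ n)"
    by (rule uniform_limit_theorem[rotated]) (auto intro!: always_eventually continuous_intros)
  then have "((\<lambda>x. \<Sum>n. c n * of_real x ^ n) \<longlongrightarrow> (\<Sum>n. c n * of_real 1 ^ n))
      (at (1::real) within {0..1})"
    unfolding continuous_on_def by (rule bspec) simp
  then show ?thesis
    by (simp add: at_within_Icc_at_left)
qed

section \<open>Discrete symbol estimates and their stability under products\<close>

text \<open>
  The discrete analogue of a symbol estimate of order \<open>a\<close>, uniform in the parameter: each
  difference gains one power of \<open>n\<close>. Such estimates are stable under products.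
\<close>

definition symbol_on :: "'a set \<Rightarrow> real \<Rightarrow> ('a \<Rightarrow> nat \<Rightarrow> complex) \<Rightarrow> bool" where
  "symbol_on K a f \<longleftrightarrow> (\<exists>C. \<forall>s\<in>K. \<forall>n.
     norm (f s n) \<le> C * (real n + 1) powr a \<and>
     norm (bdiff (f s) n) \<le> C * (real n + 1) powr (a - 1) \<and>
     norm (bdiff (bdiff (f s)) n) \<le> C * (real n + 1) powr (a - 2))"

text \<open>This absorbs the shifted arguments of the product rules, since
  \<open>n + k + 1 \<le> 3 * (n + 1)\<close>. The absolute value in the exponent covers negative
  \<open>a\<close>, where the power decreases and the factor only has to be at least 1.\<close>

lemma powr_shift_le:
  assumes "k \<le> 2"
  shows "(real (n + k) + 1) powr a \<le> 3 powr \<bar>a\<bar> * (real n + 1) powr a"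
proof (cases "a \<ge> 0")
  case True
  have "(real (n + k) + 1) powr a \<le> (3 * (real n + 1)) powr a"
    using assms True by (intro powr_mono2) auto
  also have "\<dots> = 3 powr \<bar>a\<bar> * (real n + 1) powr a"
    unfolding powr_mult using True by simp
  finally show ?thesis .
next
  case False
  have "(real (n + k) + 1) powr a \<le> 1 * (real n + 1) powr a"
    using False by (simp add: powr_mono2')
  also have "\<dots> \<le> 3 powr \<bar>a\<bar> * (real n + 1) powr a"
    by (intro mult_right_mono) (auto simp: ge_one_powr_ge_zero)
  finally show ?thesis .
qed

text \<open>In the product rules for first and second differences the orders of the two factors
  always add up to the required one. The second difference has four terms counted with multiplicity,
  whence the factor 4.\<close>

lemma symbol_on_mult:
  assumes "symbol_on K a f" and "symbol_on K b g"
  shows "symbol_on K (a + b) (\<lambda>s n. f s n * g s n)"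
proof -
  obtain C where C: "\<And>s n. s \<in> K \<Longrightarrow>
     norm (f s n) \<le> C * (real n + 1) powr a \<and>
     norm (bdiff (f s) n) \<le> C * (real n + 1) powr (a - 1) \<and>
     norm (bdiff (bdiff (f s)) n) \<le> C * (real n + 1) powr (a - 2)"
    using assms(1) unfolding symbol_on_def by blast
  obtain D where D: "\<And>s n. s \<in> K \<Longrightarrow>
     norm (g s n) \<le> D * (real n + 1) powr b \<and>
     norm (bdiff (g s) n) \<le> D * (real n + 1) powr (b - 1) \<and>
     norm (bdiff (bdiff (g s)) n) \<le> D * (real n + 1) powr (b - 2)"
    using assms(2) unfolding symbol_on_def by blast
  \<comment> \<open>Only \<open>f\<close> and its first difference occur at shifted arguments;
    \<open>M\<close> bounds the cost of both shifts.\<close>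
  define M where "M = 3 powr \<bar>a\<bar> + 3 powr \<bar>a - 1\<bar>"
  have M1: "M \<ge> 1" unfolding M_def
    using ge_one_powr_ge_zero[of 3 "\<bar>a\<bar>"] by (smt (verit) powr_ge_zero abs_ge_zero)
  have M2: "3 powr \<bar>a\<bar> \<le> M" "3 powr \<bar>a - 1\<bar> \<le> M" by (auto simp: M_def)
  have main: "norm (f s n * g s n) \<le> 4 * M * C * D * (real n + 1) powr (a + b) \<and>
     norm (bdiff (\<lambda>n. f s n * g s n) n) \<le> 4 * M * C * D * (real n + 1) powr (a + b - 1) \<and>
     norm (bdiff (bdiff (\<lambda>n. f s n * g s n)) n) \<le> 4 * M * C * D * (real n + 1) powr (a + b - 2)"
    if s: "s \<in> K" for s n
  proof -
    \<comment> \<open>\<open>K\<close> may be empty, so the signs of the constants are available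
      only once a point \<open>s\<close> of \<open>K\<close> is given.\<close>
    have CD: "0 \<le> C" "0 \<le> D"
      using C[OF s, of 0] D[OF s, of 0] order_trans[OF norm_ge_zero] by fastforce+
    define t where "t = real n + 1"
    have t: "t > 0" by (simp add: t_def)
    have f0: "norm (f s n) \<le> M * C * t powr a"
      using C[OF s, of n] mult_right_mono[OF M1, of "C * t powr a"] CD by (simp add: t_def algebra_simps)
    have f0': "norm (f s (n + k)) \<le> M * C * t powr a" if "k \<le> 2" for k
    proof -
      have "norm (f s (n + k)) \<le> C * (real (n + k) + 1) powr a" using C[OF s] by blast
      also have "\<dots> \<le> C * (3 powr \<bar>a\<bar> * t powr a)"
        unfolding t_def by (intro mult_left_mono powr_shift_le that CD)
      also have "\<dots> \<le> C * (M * t powr a)"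
        by (intro mult_left_mono mult_right_mono M2 CD) auto
      finally show ?thesis by (simp add: algebra_simps)
    qed
    have f1': "norm (bdiff (f s) (n + k)) \<le> M * C * t powr (a - 1)" if "k \<le> 2" for k
    proof -
      have "norm (bdiff (f s) (n + k)) \<le> C * (real (n + k) + 1) powr (a - 1)" using C[OF s] by blast
      also have "\<dots> \<le> C * (3 powr \<bar>a - 1\<bar> * t powr (a - 1))"
        unfolding t_def by (intro mult_left_mono powr_shift_le that CD)
      also have "\<dots> \<le> C * (M * t powr (a - 1))"
        by (intro mult_left_mono mult_right_mono M2 CD) auto
      finally show ?thesis by (simp add: algebra_simps)
    qed
    have f2: "norm (bdiff (bdiff (f s)) n) \<le> M * C * t powr (a - 2)"
      using C[OF s, of n] mult_right_mono[OF M1, of "C * t powr (a - 2)"] CD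
      by (simp add: t_def algebra_simps)
    have g: "norm (g s n) \<le> D * t powr b" "norm (bdiff (g s) n) \<le> D * t powr (b - 1)"
      "norm (bdiff (bdiff (g s)) n) \<le> D * t powr (b - 2)"
      using D[OF s, of n] by (auto simp: t_def)
    have prod: "norm (u * v) \<le> M * C * D * t powr (p + q)"
      if "norm u \<le> M * C * t powr p" "norm v \<le> D * t powr q" for u v :: complex and p q
      using mult_mono'[OF that] by (simp add: norm_mult powr_add algebra_simps)
    have nn: "0 \<le> M * C * D * t powr p" for p using CD M1 by simp
    have 0: "norm (f s n * g s n) \<le> 4 * (M * C * D * t powr (a + b))"
      using prod[OF f0 g(1)] nn[of "a + b"] by linarith
    have 1: "norm (bdiff (\<lambda>n. f s n * g s n) n) \<le> 4 * (M * C * D * t powr (a + b - 1))"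
    proof -
      have "norm (bdiff (f s) n * g s n) \<le> M * C * D * t powr (a + b - 1)"
        using prod[OF f1'[of 0, simplified] g(1)] by (simp add: algebra_simps)
      moreover have "norm (f s (Suc n) * bdiff (g s) n) \<le> M * C * D * t powr (a + b - 1)"
        using prod[OF f0'[of 1, simplified] g(2)] by (simp add: algebra_simps)
      ultimately show ?thesis
        unfolding bdiff_mult using nn[of "a + b - 1"]
        by (intro norm_triangle_le) linarith
    qed
    have 2: "norm (bdiff (bdiff (\<lambda>n. f s n * g s n)) n) \<le> 4 * (M * C * D * t powr (a + b - 2))"
    proof -
      have "norm (bdiff (bdiff (f s)) n * g s n) \<le> M * C * D * t powr (a + b - 2)"
        using prod[OF f2 g(1)] by (simp add: algebra_simps)
      moreover have "norm (bdiff (f s) (Suc n) * bdiff (g s) n) \<le> M * C * D * t powr (a + b - 2)"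
        using prod[OF f1'[of 1, simplified] g(2)] by (simp add: algebra_simps)
      moreover have "norm (f s (Suc (Suc n)) * bdiff (bdiff (g s)) n) \<le> M * C * D * t powr (a + b - 2)"
        using prod[OF f0'[of 2, simplified] g(3)] by (simp add: algebra_simps)
      moreover have "norm (2 * x :: complex) = 2 * norm x" for x by (simp add: norm_mult)
      ultimately show ?thesis
        unfolding bdiff2_mult by (intro norm_triangle_le) (smt (verit) norm_triangle_ineq)
    qed
    show ?thesis using 0 1 2 by (simp add: t_def algebra_simps)
  qed
  show ?thesis unfolding symbol_on_def by (rule exI[of _ "4 * M * C * D"]) (use main in blast)
qed

lemma symbol_on_1:
  assumes "0 \<le> a"
  shows "symbol_on K a (\<lambda>s n. 1)"
  unfolding symbol_on_def bdiff_def
  by (rule exI[of _ 1]) (use assms in \<open>simp add: ge_one_powr_ge_zero\<close>)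

lemma symbol_on_power:
  assumes "symbol_on K a f"
  shows "symbol_on K (real m * a) (\<lambda>s n. f s n ^ m)"
proof (induction m)
  case 0
  then show ?case by (simp add: symbol_on_1)
next
  case (Suc m)
  then show ?case using symbol_on_mult[OF assms Suc.IH] by (simp add: algebra_simps)
qed

section \<open>Symbol estimates for harmonic numbers and complex powers\<close>

lemma harm_le_powr:
  assumes "0 < e"
  shows "harm (Suc n) \<le> (1 + 1 / e) * (real n + 1) powr e"
proof -
  \<comment> \<open>The difference between a harmonic number and the logarithm decreases from the
    value 1, and the logarithm is below any positive power up to a constant.\<close>
  have "harm (Suc n) - ln (real (Suc n)) \<le> (harm (Suc 0) - ln (real (Suc 0)) :: real)"
    by (rule decseqD[OF decseq_harm_diff_ln]) simp
  then have 1: "harm (Suc n) \<le> 1 + ln (real n + 1)"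
    by (simp add: harm_expand add.commute)
  have 2: "ln (real n + 1) \<le> (real n + 1) powr e / e"
    by (rule ln_powr_bound) (use assms in auto)
  have 3: "1 \<le> (real n + 1) powr e"
    using assms by (simp add: ge_one_powr_ge_zero)
  have "(1 + 1 / e) * (real n + 1) powr e = (real n + 1) powr e + (real n + 1) powr e / e"
    by (simp add: algebra_simps)
  then show ?thesis using 1 2 3 by linarith
qed

text \<open>Growth is logarithmic, hence of any positive order \<open>e\<close>; the differences are
  explicit reciprocals of orders -1 and -2, better than the required \<open>e - 1\<close> and
  \<open>e - 2\<close>.\<close>

lemma symbol_on_harm:
  assumes "0 < e"
  shows "symbol_on K e (\<lambda>s n. harm (Suc n))"
proof -
  have d1: "bdiff (\<lambda>n. harm (Suc n)) n = (- 1 / of_nat (n + 2) :: complex)" for n :: nat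
    by (simp add: bdiff_def harm_Suc[of "Suc n"] field_simps)
  have d2: "bdiff (bdiff (\<lambda>n. harm (Suc n))) n = (- 1 / of_nat ((n + 2) * (n + 3)) :: complex)" for n :: nat
  proof -
    have "- 1 / x - - 1 / (x + 1) = - 1 / (x * (x + 1))" if "x \<noteq> 0" "x + 1 \<noteq> 0" for x :: complex
      using that by (simp add: divide_simps)
    from this[of "of_nat (n + 2)"] have "- 1 / of_nat (n + 2) - - 1 / of_nat (Suc (n + 2)) =
        (- 1 / (of_nat (n + 2) * of_nat (Suc (n + 2))) :: complex)"
      using of_nat_neq_0[of "n + 2", where 'a = complex] of_nat_neq_0[of "n + 1", where 'a = complex]
      by (simp only: of_nat_Suc add.commute[of 1] add_2_eq_Suc' Suc_eq_plus1[symmetric]) simp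
    then show ?thesis
      by (simp add: bdiff_def[of "bdiff _"] d1 numeral_3_eq_3 del: of_nat_Suc mult_Suc_right mult_Suc)
  qed
  have "norm (harm (Suc n) :: complex) \<le> (1 + 1 / e) * (real n + 1) powr e \<and>
     norm (bdiff (\<lambda>n. harm (Suc n) :: complex) n) \<le> (1 + 1 / e) * (real n + 1) powr (e - 1) \<and>
     norm (bdiff (bdiff (\<lambda>n. harm (Suc n) :: complex)) n) \<le> (1 + 1 / e) * (real n + 1) powr (e - 2)"
    for n
  proof (intro conjI)
    have e: "1 \<le> (1 + 1 / e) * (real n + 1) powr e"
      using mult_mono[of 1 "1 + 1 / e" 1 "(real n + 1) powr e"] assms
      by (simp add: ge_one_powr_ge_zero)
    show "norm (harm (Suc n) :: complex) \<le> (1 + 1 / e) * (real n + 1) powr e"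
      using harm_le_powr[OF assms, of n] by (simp add: norm_harm)
    have "norm (bdiff (\<lambda>n. harm (Suc n) :: complex) n) = 1 / (real n + 2)"
      unfolding d1 norm_divide norm_of_nat by (simp add: add.commute)
    also have "\<dots> \<le> 1 / (real n + 1)" by (simp add: frac_le)
    also have "\<dots> \<le> (1 + 1 / e) * (real n + 1) powr e / (real n + 1)"
      using e by (intro divide_right_mono) auto
    finally show "norm (bdiff (\<lambda>n. harm (Suc n) :: complex) n) \<le> (1 + 1 / e) * (real n + 1) powr (e - 1)"
      by (simp add: powr_diff)
    have "norm (bdiff (bdiff (\<lambda>n. harm (Suc n) :: complex)) n) = 1 / ((real n + 2) * (real n + 3))"
      unfolding d2 norm_divide norm_of_nat by (simp add: algebra_simps)
    also have "\<dots> \<le> 1 / ((real n + 1) * (real n + 1))" by (intro frac_le mult_mono) auto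
    also have "\<dots> \<le> (1 + 1 / e) * (real n + 1) powr e / ((real n + 1) * (real n + 1))"
      using e by (intro divide_right_mono) auto
    finally show "norm (bdiff (bdiff (\<lambda>n. harm (Suc n) :: complex)) n) \<le> (1 + 1 / e) * (real n + 1) powr (e - 2)"
      by (simp add: powr_diff power2_eq_square)
  qed
  then show ?thesis unfolding symbol_on_def by (intro exI[of _ "1 + 1 / e"]) blast
qed

lemma closed_segment_of_realE:
  assumes "z \<in> closed_segment (of_real a) (of_real b :: complex)" "a \<le> b"
  obtains u where "z = of_real u" "a \<le> u" "u \<le> b"
  using assms by (auto simp: closed_segment_of_real closed_segment_eq_real_ivl)

text \<open>Mean value inequality on the segment from \<open>t\<close> to \<open>t + 1\<close>. As
  \<open>Re w \<le> 1\<close>, the bound on the derivative is largest at the left end.\<close>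

lemma norm_powr_diff_le:
  assumes "0 < t" and "Re w \<le> 1"
  shows "norm (of_real t powr w - (of_real t + 1) powr w) \<le> norm w * t powr (Re w - 1)"
proof -
  let ?S = "closed_segment (of_real t) (of_real (t + 1)) :: complex set"
  have "norm (of_real t powr w - of_real (t + 1) powr w)
      \<le> (norm w * t powr (Re w - 1)) * norm (of_real t - of_real (t + 1) :: complex)"
  proof (rule field_differentiable_bound[where S = ?S and f' = "\<lambda>z. w * z powr (w - 1)"])
    fix z assume "z \<in> ?S"
    then obtain u where u: "z = of_real u" "t \<le> u" "u \<le> t + 1"
      by (rule closed_segment_of_realE) simp
    show "((\<lambda>z. z powr w) has_field_derivative w * z powr (w - 1)) (at z within ?S)"
      by (rule has_field_derivative_at_within[OF has_field_derivative_powr])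
        (use u assms in \<open>simp add: complex_nonpos_Reals_iff\<close>)
    have "norm (z powr (w - 1)) = u powr (Re w - 1)"
      using u assms by (simp add: norm_powr_real_powr)
    also have "\<dots> \<le> t powr (Re w - 1)"
      using u assms by (intro powr_mono2') auto
    finally show "norm (w * z powr (w - 1)) \<le> norm w * t powr (Re w - 1)"
      by (simp add: norm_mult mult_left_mono)
  qed auto
  then show ?thesis by simp
qed

text \<open>The mean value inequality is applied to the first difference as a function of its base
  point: its derivative is \<open>w\<close> times the first difference for the exponent
  \<open>w - 1\<close>, which \<open>norm_powr_diff_le\<close> bounds.\<close>

lemma norm_powr_diff2_le:
  assumes "0 < t" and "Re w \<le> 1"
  shows "norm ((of_real t powr w - (of_real t + 1) powr w) - ((of_real t + 1) powr w - (of_real t + 2) powr w))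
    \<le> norm w * norm (w - 1) * t powr (Re w - 2)"
proof -
  let ?S = "closed_segment (of_real t) (of_real (t + 1)) :: complex set"
  let ?k = "\<lambda>z. z powr w - (z + 1) powr w :: complex"
  have "norm (?k (of_real t) - ?k (of_real (t + 1)))
      \<le> (norm w * norm (w - 1) * t powr (Re w - 2)) * norm (of_real t - of_real (t + 1) :: complex)"
  proof (rule field_differentiable_bound[where S = ?S
        and f' = "\<lambda>z. w * (z powr (w - 1) - (z + 1) powr (w - 1))"])
    fix z assume "z \<in> ?S"
    then obtain u where u: "z = of_real u" "t \<le> u" "u \<le> t + 1"
      by (rule closed_segment_of_realE) simp
    show "(?k has_field_derivative w * (z powr (w - 1) - (z + 1) powr (w - 1))) (at z within ?S)"
      using u assms
      by (auto intro!: derivative_eq_intros simp: complex_nonpos_Reals_iff algebra_simps)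
    have "norm (z powr (w - 1) - (z + 1) powr (w - 1)) \<le> norm (w - 1) * u powr (Re (w - 1) - 1)"
      unfolding u(1) using u assms by (intro norm_powr_diff_le) auto
    also have "\<dots> \<le> norm (w - 1) * t powr (Re w - 2)"
      using u assms by (auto intro!: mult_left_mono powr_mono2')
    finally show "norm (w * (z powr (w - 1) - (z + 1) powr (w - 1))) \<le> norm w * norm (w - 1) * t powr (Re w - 2)"
      by (simp add: norm_mult mult_left_mono mult.assoc)
  qed auto
  then show ?thesis by (simp add: algebra_simps)
qed

text \<open>Both difference bounds are used with \<open>w = - s\<close>, where
  \<open>-1 \<le> c\<close> ensures \<open>Re w \<le> 1\<close>. The constant
  \<open>(1 + R) ^ 2\<close> dominates 1, \<open>norm s\<close> and
  \<open>norm s * norm (- s - 1)\<close> throughout \<open>K\<close>.\<close>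

lemma symbol_on_powr:
  assumes "\<And>s. s \<in> K \<Longrightarrow> norm s \<le> R" and "\<And>s. s \<in> K \<Longrightarrow> c \<le> Re s" and "-1 \<le> c"
  shows "symbol_on K (- c) (\<lambda>s n. of_nat (Suc n) powr (- s))"
proof -
  have "norm (of_nat (Suc n) powr (- s)) \<le> (1 + R) ^ 2 * (real n + 1) powr (- c) \<and>
     norm (bdiff (\<lambda>n. of_nat (Suc n) powr (- s)) n) \<le> (1 + R) ^ 2 * (real n + 1) powr (- c - 1) \<and>
     norm (bdiff (bdiff (\<lambda>n. of_nat (Suc n) powr (- s))) n) \<le> (1 + R) ^ 2 * (real n + 1) powr (- c - 2)"
    if s: "s \<in> K" for s n
  proof (intro conjI)
    define t where "t = real n + 1"
    have t: "t \<ge> 1" by (simp add: t_def)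
    have R: "norm s \<le> R" "0 \<le> R" "c \<le> Re s" using assms(1,2)[OF s] order_trans[OF norm_ge_zero[of s]] by auto
    have "norm (- s - 1) \<le> 1 + R" using norm_triangle_ineq4[of "- s" 1] R by simp
    have R2: "1 \<le> (1 + R) ^ 2" "norm s \<le> (1 + R) ^ 2" "norm s * norm (- s - 1) \<le> (1 + R) ^ 2"
    proof -
      show "1 \<le> (1 + R) ^ 2" using R by simp
      show "norm s \<le> (1 + R) ^ 2" using R by (simp add: power2_eq_square algebra_simps) (smt (verit) mult_nonneg_nonneg)
      show "norm s * norm (- s - 1) \<le> (1 + R) ^ 2"
        unfolding power2_eq_square using R \<open>norm (- s - 1) \<le> 1 + R\<close> by (intro mult_mono) auto
    qed
    have tp: "t powr (Re (- s) - k) \<le> t powr (- c - k)" for k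
      using t R by (intro powr_mono) auto
    have T: "of_nat (Suc n) = (of_real t :: complex)" by (simp add: t_def add.commute)
    have T1: "of_nat (Suc (Suc n)) = (of_real t + 1 :: complex)" by (simp add: t_def add.commute)
    have T2: "of_nat (Suc (Suc (Suc n))) = (of_real t + 2 :: complex)" by (simp add: t_def)
    have "norm (of_nat (Suc n) powr (- s)) = t powr (Re (- s) - 0)"
      unfolding T using t by (simp add: norm_powr_real_powr)
    also have "\<dots> \<le> 1 * t powr (- c - 0)" using tp[of 0] by simp
    also have "\<dots> \<le> (1 + R) ^ 2 * t powr (- c - 0)" by (intro mult_right_mono R2) auto
    finally show "norm (of_nat (Suc n) powr (- s)) \<le> (1 + R) ^ 2 * (real n + 1) powr (- c)"
      by (simp add: t_def)
    have "norm (bdiff (\<lambda>n. of_nat (Suc n) powr (- s)) n) \<le> norm (- s) * t powr (Re (- s) - 1)"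
      unfolding bdiff_def T T1 using t R assms(3) by (intro norm_powr_diff_le) auto
    also have "\<dots> \<le> (1 + R) ^ 2 * t powr (- c - 1)"
      by (intro mult_mono tp) (use R2 in auto)
    finally show "norm (bdiff (\<lambda>n. of_nat (Suc n) powr (- s)) n) \<le> (1 + R) ^ 2 * (real n + 1) powr (- c - 1)"
      by (simp add: t_def)
    have "norm (bdiff (bdiff (\<lambda>n. of_nat (Suc n) powr (- s))) n)
        \<le> norm (- s) * norm (- s - 1) * t powr (Re (- s) - 2)"
      unfolding bdiff_def T T1 T2 using t R assms(3) by (intro norm_powr_diff2_le) auto
    also have "\<dots> \<le> (1 + R) ^ 2 * t powr (- c - 2)"
      by (intro mult_mono tp) (use R2 in auto)
    finally show "norm (bdiff (bdiff (\<lambda>n. of_nat (Suc n) powr (- s))) n) \<le> (1 + R) ^ 2 * (real n + 1) powr (- c - 2)"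
      by (simp add: t_def)
  qed
  then show ?thesis unfolding symbol_on_def by (intro exI[of _ "(1 + R) ^ 2"]) blast
qed

lemma symbol_on_harm_powr:
  assumes "\<And>s. s \<in> K \<Longrightarrow> norm s \<le> R" and "\<And>s. s \<in> K \<Longrightarrow> c \<le> Re s" and "-1 \<le> c" and "- c < a"
  shows "symbol_on K a (\<lambda>s n. harm (Suc n) ^ m * of_nat (Suc n) powr (- s))"
proof (cases "m = 0")
  case True
  show ?thesis
  proof -
    \<comment> \<open>Without harmonic factors, the constant 1 takes up the slack
      \<open>a + c\<close>.\<close>
    have "symbol_on K ((a + c) + - c) (\<lambda>s n. 1 * of_nat (Suc n) powr (- s))"
      by (intro symbol_on_mult symbol_on_1 symbol_on_powr[where R = R] assms) (use assms in auto)
    then show ?thesis using True by simp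
  qed
next
  case False
  \<comment> \<open>The slack \<open>a + c\<close> is shared equally among the \<open>m\<close>
    harmonic factors.\<close>
  define e where "e = (a + c) / real m"
  have e: "0 < e" "real m * e = a + c" using False assms by (auto simp: e_def)
  have "symbol_on K (real m * e + - c) (\<lambda>s n. harm (Suc n) ^ m * of_nat (Suc n) powr (- s))"
    by (intro symbol_on_mult symbol_on_power symbol_on_harm symbol_on_powr[where R = R] e(1) assms)
  then show ?thesis using e by simp
qed

section \<open>Ordinary sums, Abel sums and holomorphy from symbol estimates\<close>

lemma symbol_on_tendsto_0:
  assumes "symbol_on K a f" and "s \<in> K"
  shows "a < 0 \<Longrightarrow> f s \<longlonglongrightarrow> 0" and "a < 1 \<Longrightarrow> bdiff (f s) \<longlonglongrightarrow> 0"
proof -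
  obtain C where C: "\<And>n. norm (f s n) \<le> C * (real n + 1) powr a"
    "\<And>n. norm (bdiff (f s) n) \<le> C * (real n + 1) powr (a - 1)"
    using assms unfolding symbol_on_def by blast
  have lim: "(\<lambda>n. C * (real n + 1) powr b) \<longlonglongrightarrow> 0" if "b < 0" for b
  proof -
    have "filterlim (\<lambda>n. real n + 1) at_top sequentially"
      using filterlim_compose[OF filterlim_real_sequentially filterlim_Suc]
      by (simp add: add.commute)
    from tendsto_neg_powr[OF that this] show ?thesis
      using tendsto_mult_right_zero by blast
  qed
  show "f s \<longlonglongrightarrow> 0" if "a < 0"
    by (rule Lim_null_comparison[OF always_eventually[rule_format, OF C(1)] lim[OF that]])
  show "bdiff (f s) \<longlonglongrightarrow> 0" if "a < 1"
    by (rule Lim_null_comparison[OF always_eventually[rule_format, OF C(2)] lim]) (use that in simp)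
qed

text \<open>Second differences have order \<open>a - 2 < -1\<close>, so a convergent p-series
  dominates them uniformly on \<open>K\<close>.\<close>

lemma symbol_on_summable_majorant:
  assumes "symbol_on K a f" and "a < 1"
  obtains M where "summable M"
    and "\<And>s n. s \<in> K \<Longrightarrow> norm ((-1) ^ n * bdiff (bdiff (f s)) n) \<le> M n"
proof -
  obtain C where C: "\<And>s n. s \<in> K \<Longrightarrow> norm (bdiff (bdiff (f s)) n) \<le> C * (real n + 1) powr (a - 2)"
    using assms(1) unfolding symbol_on_def by blast
  have "summable (\<lambda>n. real (Suc n) powr (a - 2))"
    using assms(2) by (subst summable_Suc_iff) (simp add: summable_real_powr_iff)
  then have "summable (\<lambda>n. C * (real n + 1) powr (a - 2))"
    by (intro summable_mult) (simp add: add.commute)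
  then show ?thesis
    by (rule that) (simp add: norm_mult norm_power C)
qed

lemma symbol_on_summable_bdiff2:
  assumes "symbol_on K a f" and "a < 1" and "s \<in> K"
  shows "summable (\<lambda>n. norm ((-1) ^ n * bdiff (bdiff (f s)) n))"
proof -
  obtain M where M: "summable M"
    "\<And>s n. s \<in> K \<Longrightarrow> norm ((-1) ^ n * bdiff (bdiff (f s)) n) \<le> M n"
    using symbol_on_summable_majorant[OF assms(1,2)] by blast
  show ?thesis
    by (rule summable_comparison_test'[OF M(1), where N = 0])
      (use M(2)[OF assms(3)] in \<open>simp only: real_norm_def abs_norm_cancel\<close>)
qed

text \<open>The differences tend to 0 since \<open>a < 1\<close>, so their alternating series
  converges even where that of \<open>f s\<close> need not; its value is read off from the outer
  step in \<open>euler_value\<close>.\<close>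

lemma symbol_on_sums_bdiff:
  assumes "symbol_on K a f" and "a < 1" and "s \<in> K"
  shows "(\<lambda>n. (-1) ^ n * bdiff (f s) n) sums (2 * euler_value (f s) - f s 0)"
proof -
  have "(\<lambda>n. (-1) ^ n * bdiff (bdiff (f s)) n) sums (\<Sum>n. (-1) ^ n * bdiff (bdiff (f s)) n)"
    by (rule summable_sums[OF summable_norm_cancel[OF symbol_on_summable_bdiff2[OF assms]]])
  note alternating_sums_bdiff[OF symbol_on_tendsto_0(2)[OF assms(1,3,2)] this]
  moreover have "2 * euler_value (f s) - f s 0 =
      (bdiff (f s) 0 + (\<Sum>n. (-1) ^ n * bdiff (bdiff (f s)) n)) / 2"
    by (simp add: euler_value_def field_simps)
  ultimately show ?thesis by (simp only:)
qed

text \<open>For negative order \<open>f s\<close> itself tends to 0, so both summation steps are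
  valid and \<open>euler_value\<close> is the ordinary sum.\<close>

lemma symbol_on_sums:
  assumes "symbol_on K a f" and "a < 0" and "s \<in> K"
  shows "(\<lambda>n. (-1) ^ n * f s n) sums euler_value (f s)"
  using alternating_sums_bdiff[OF symbol_on_tendsto_0(1)[OF assms(1,3,2)] symbol_on_sums_bdiff[OF assms(1) _ assms(3)]]
    assms(2) by simp

text \<open>The Abel limit of the absolutely convergent second-difference series is carried back
  through two summation steps. Orders below 1 stay within the linear growth these steps
  allow.\<close>

lemma symbol_on_abel:
  assumes "symbol_on K a f" and "a < 1" and "s \<in> K"
  shows "((\<lambda>x. \<Sum>n. (-1) ^ n * f s n * of_real x ^ n) \<longlongrightarrow> euler_value (f s)) (at_left 1)"
proof -
  obtain C where C: "\<And>n. norm (f s n) \<le> C * (real n + 1) powr a"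
    "\<And>n. norm (bdiff (f s) n) \<le> C * (real n + 1) powr (a - 1)"
    using assms(1,3) unfolding symbol_on_def by blast
  have "0 \<le> C" using order_trans[OF norm_ge_zero C(1)[of 0]] by simp
  then have lin: "C * (real n + 1) powr b \<le> C * (real n + 1)" if "b \<le> 1" for n b
    using powr_mono[OF that, of "real n + 1"] by (intro mult_left_mono) auto
  have b: "norm (f s n) \<le> C * (real n + 1)" "norm (bdiff (f s) n) \<le> C * (real n + 1)" for n
    using assms(2) order_trans[OF C(1)[of n] lin] order_trans[OF C(2)[of n] lin] by simp_all
  have "((\<lambda>x. \<Sum>n. (-1) ^ n * bdiff (bdiff (f s)) n * of_real x ^ n)
      \<longlongrightarrow> (\<Sum>n. (-1) ^ n * bdiff (bdiff (f s)) n)) (at_left (1::real))"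
    by (rule abel_limit_absolutely_convergent[OF symbol_on_summable_bdiff2[OF assms]])
  then have "((\<lambda>x. \<Sum>n. (-1) ^ n * bdiff (f s) n * of_real x ^ n)
      \<longlongrightarrow> (bdiff (f s) 0 + (\<Sum>n. (-1) ^ n * bdiff (bdiff (f s)) n)) / 2) (at_left (1::real))"
    by (rule alternating_abel_bdiff[OF b(2)])
  then show ?thesis
    unfolding euler_value_def
    by (rule alternating_abel_bdiff[OF b(1)])
qed

text \<open>The majorant gives uniform convergence on small closed discs, so the Weierstrass theorem
  applies; the order \<open>a\<close> may change from disc to disc.\<close>

lemma holomorphic_euler_value:
  assumes "open S" and hol: "\<And>n. (\<lambda>s. f s n) holomorphic_on S"
    and loc: "\<And>z. z \<in> S \<Longrightarrow> \<exists>d a. 0 < d \<and> cball z d \<subseteq> S \<and> a < 1 \<and> symbol_on (cball z d) a f"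
  shows "(\<lambda>s. euler_value (f s)) holomorphic_on S"
proof -
  have h: "(\<lambda>s. \<Sum>n. (-1) ^ n * bdiff (bdiff (f s)) n) holomorphic_on S"
  proof (rule holomorphic_uniform_sequence[OF \<open>open S\<close>])
    show "(\<lambda>s. \<Sum>n<N. (-1) ^ n * bdiff (bdiff (f s)) n) holomorphic_on S" for N
      unfolding bdiff_def by (intro holomorphic_intros hol)
    fix z assume "z \<in> S"
    then obtain d a where d: "0 < d" "cball z d \<subseteq> S" "a < 1" "symbol_on (cball z d) a f"
      using loc by blast
    obtain M where "summable M"
      and "\<And>s n. s \<in> cball z d \<Longrightarrow> norm ((-1) ^ n * bdiff (bdiff (f s)) n) \<le> M n"
      using symbol_on_summable_majorant[OF d(4,3)] by blast
    then have "uniform_limit (cball z d) (\<lambda>N s. \<Sum>n<N. (-1) ^ n * bdiff (bdiff (f s)) n)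
        (\<lambda>s. \<Sum>n. (-1) ^ n * bdiff (bdiff (f s)) n) sequentially"
      by (intro Weierstrass_m_test)
    with d show "\<exists>d>0. cball z d \<subseteq> S \<and>
        uniform_limit (cball z d) (\<lambda>N s. \<Sum>n<N. (-1) ^ n * bdiff (bdiff (f s)) n)
        (\<lambda>s. \<Sum>n. (-1) ^ n * bdiff (bdiff (f s)) n) sequentially"
      by blast
  qed
  show ?thesis
    unfolding euler_value_def bdiff_def[of _ 0] by (intro holomorphic_intros hol h) auto
qed

section \<open>Continuation and Abel value of the harmonic eta function\<close>

abbreviation harm_term :: "nat \<Rightarrow> complex \<Rightarrow> nat \<Rightarrow> complex" where
  "harm_term j s n \<equiv> harm (Suc n) ^ j * of_nat (Suc n) powr (- s)"

lemma harm_term_sums: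
  assumes "Re s > 0"
  shows "(\<lambda>n. (-1) ^ n * harm_term j s n) sums harm_eta j s"
    and "harm_eta j s = euler_value (harm_term j s)"
proof -
  \<comment> \<open>The order lies strictly between \<open>- Re s\<close> and 0: room for the
    harmonic factors, yet ordinary convergence.\<close>
  have "symbol_on {s} (- Re s / 2) (harm_term j)"
    by (rule symbol_on_harm_powr[where R = "norm s" and c = "Re s"]) (use assms in auto)
  then have *: "(\<lambda>n. (-1) ^ n * harm_term j s n) sums euler_value (harm_term j s)"
    by (rule symbol_on_sums) (use assms in auto)
  then show "harm_eta j s = euler_value (harm_term j s)"
    unfolding harm_eta_def by (simp add: sums_iff mult.assoc)
  with * show "(\<lambda>n. (-1) ^ n * harm_term j s n) sums harm_eta j s" by simp
qed

lemma holomorphic_euler_value_harm: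
  "(\<lambda>s. euler_value (harm_term j s)) holomorphic_on {s. Re s > -1}"
proof (rule holomorphic_euler_value)
  show "open {s. Re s > -1}" by (rule open_halfspace_Re_gt)
  show "(\<lambda>s. harm_term j s n) holomorphic_on {s. Re s > -1}" for n
    by (intro holomorphic_intros)
  fix z assume "z \<in> {s. Re s > -1}"
  then have z: "Re z > -1" by simp
  \<comment> \<open>Half the distance to the line \<open>Re s = -1\<close>, which keeps the disc
    inside the half-plane and leaves room for an order below 1.\<close>
  define d where "d = (Re z + 1) / 2"
  have d: "d > 0" "Re z - d > -1" using z by (auto simp: d_def field_simps)
  have ball: "norm s \<le> norm z + d" "Re z - d \<le> Re s" if "s \<in> cball z d" for s
  proof -
    have "norm (s - z) \<le> d" using that by (simp add: dist_norm norm_minus_commute)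
    then show "norm s \<le> norm z + d" using norm_triangle_sub[of s z] by linarith
    show "Re z - d \<le> Re s"
      using abs_Re_le_cmod[of "s - z"] \<open>norm (s - z) \<le> d\<close> by simp
  qed
  obtain a where a: "- (Re z - d) < a" "a < 1"
    using dense[of "- (Re z - d)" 1] d by auto
  have "symbol_on (cball z d) a (harm_term j)"
    by (rule symbol_on_harm_powr[where R = "norm z + d" and c = "Re z - d"]) (use ball a d in auto)
  moreover have "cball z d \<subseteq> {s. Re s > -1}"
    using ball d by fastforce
  ultimately show "\<exists>d a. 0 < d \<and> cball z d \<subseteq> {s. Re s > -1} \<and> a < 1 \<and> symbol_on (cball z d) a (harm_term j)"
    using d a by blast
qed

text \<open>Any order strictly between 0 and 1 would do: positive to absorb the powers of harmonic
  numbers, below 1 for the Abel limit.\<close>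

lemma symbol_on_harm_0: "symbol_on {0} (1 / 2) (harm_term j)"
  by (rule symbol_on_harm_powr[where R = 0 and c = 0]) auto

text \<open>\<open>harm_eta_abel\<close> carries \<open>x ^ Suc n\<close>, one factor
  \<open>x\<close> more than the series in \<open>symbol_on_abel\<close>; this factor tends to
  1.\<close>

lemma harm_eta_abel_tendsto:
  "(harm_eta_abel j \<longlongrightarrow> euler_value (harm_term j 0)) (at_left 1)"
proof -
  have "((\<lambda>x. of_real x * (\<Sum>n. (-1) ^ n * harm_term j 0 n * of_real x ^ n))
      \<longlongrightarrow> of_real 1 * euler_value (harm_term j 0)) (at_left 1)"
    by (rule tendsto_mult[OF tendsto_of_real[OF tendsto_ident_at] symbol_on_abel[OF symbol_on_harm_0]]) auto
  moreover have "\<forall>\<^sub>F x in at_left (1::real).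
      of_real x * (\<Sum>n. (-1) ^ n * harm_term j 0 n * of_real x ^ n) = harm_eta_abel j x"
  proof -
    have "\<forall>\<^sub>F x in at_left (1::real). x \<in> {0<..<1}"
      by (rule eventually_at_left_real) simp
    then show ?thesis
    proof eventually_elim
      case (elim x)
      obtain C where C: "\<And>n. norm (harm_term j 0 n) \<le> C * (real n + 1) powr (1 / 2)"
        using symbol_on_harm_0[of j] unfolding symbol_on_def by blast
      have "0 \<le> C" using order_trans[OF norm_ge_zero C[of 0]] by simp
      then have "C * (real n + 1) powr (1 / 2) \<le> C * (real n + 1)" for n
        using powr_mono[of "1 / 2" 1 "real n + 1"] by (intro mult_left_mono) auto
      with C have "norm (harm_term j 0 n) \<le> C * (real n + 1)" for n
        using order_trans by blast
      then have "summable (\<lambda>n. (-1) ^ n * harm_term j 0 n * of_real x ^ n)"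
        by (intro summable_linear_growth_power[where C = C]) (use elim in \<open>auto simp: norm_mult norm_power\<close>)
      from suminf_mult[OF this, of "of_real x"] show ?case
        unfolding harm_eta_abel_def by (simp add: algebra_simps del: of_nat_Suc)
    qed
  qed
  ultimately show ?thesis
    by (auto dest: Lim_transform_eventually)
qed

section \<open>The binomial formula for the value at 0\<close>

lemma power_diff_binomial:
  fixes a b :: "'a::comm_ring_1"
  shows "a ^ m - (a - b) ^ m = (\<Sum>k = 1..m. of_nat (m choose k) * (-1) ^ (k + 1) * (a ^ (m - k) * b ^ k))"
proof -
  have "(a - b) ^ m = (\<Sum>k\<le>m. of_nat (m choose k) * (- b) ^ k * a ^ (m - k))"
    using binomial_ring[of "- b" a m] by simp
  also have "\<dots> = a ^ m + (\<Sum>k = 1..m. of_nat (m choose k) * (- b) ^ k * a ^ (m - k))"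
    by (simp add: atMost_atLeast0 sum.atLeast_Suc_atMost)
  finally show ?thesis
    by (simp add: sum_negf[symmetric] power_minus[of b] algebra_simps)
qed

text \<open>Twice the value is the alternating sum of the increments of \<open>harm n ^ m\<close>.
  Expanding each increment binomially yields terms with \<open>k \<ge> 1\<close>, whose series
  converge separately.\<close>

lemma euler_value_harm_0:
  assumes "m \<ge> 1"
  shows "euler_value (harm_term m 0) =
    1 / 2 * (\<Sum>k = 1..m. of_nat (m choose k) * (-1) ^ (k + 1) * harm_eta (m - k) (of_nat k))"
proof -
  let ?S = "\<Sum>k = 1..m. of_nat (m choose k) * (-1) ^ (k + 1) * harm_eta (m - k) (of_nat k)"
  let ?h = "\<lambda>n. harm n ^ m :: complex"
  have "(\<lambda>n. (-1) ^ n * bdiff (harm_term m 0) n) sums (2 * euler_value (harm_term m 0) - harm_term m 0 0)"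
    by (rule symbol_on_sums_bdiff[OF symbol_on_harm_0]) auto
  then have "(\<lambda>n. (-1) ^ Suc n * (?h (Suc (Suc n)) - ?h (Suc n)))
      sums (2 * euler_value (harm_term m 0) - 1)"
    by (simp add: bdiff_def harm_expand algebra_simps del: of_nat_Suc)
  \<comment> \<open>Prepending the increment from \<open>harm 0 = 0\<close> to
    \<open>harm 1 = 1\<close> restores the missing 1; here \<open>m \<ge> 1\<close> is used, as
    \<open>0 ^ m\<close> must be 0.\<close>
  then have 1: "(\<lambda>n. (-1) ^ n * (?h (Suc n) - ?h n)) sums (2 * euler_value (harm_term m 0))"
    using assms by (subst (asm) sums_Suc_iff) (simp add: harm_expand power_0_left)
  have "(\<lambda>n. \<Sum>k = 1..m. of_nat (m choose k) * (-1) ^ (k + 1) * ((-1) ^ n * harm_term (m - k) (of_nat k) n)) sums ?S"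
    by (intro sums_sum sums_mult harm_term_sums(1)) auto
  also have "(\<lambda>n. \<Sum>k = 1..m. of_nat (m choose k) * (-1) ^ (k + 1) * ((-1) ^ n * harm_term (m - k) (of_nat k) n))
      = (\<lambda>n. (-1) ^ n * (?h (Suc n) - ?h n))"
  proof
    fix n
    have "of_nat (Suc n) powr (- of_nat k :: complex) = inverse (of_nat (Suc n)) ^ k" for k
      by (simp add: powr_minus powr_nat power_inverse del: of_nat_Suc)
    moreover have "?h (Suc n) - ?h n = (\<Sum>k = 1..m. of_nat (m choose k) * (-1) ^ (k + 1) *
        (harm (Suc n) ^ (m - k) * inverse (of_nat (Suc n)) ^ k))"
      using power_diff_binomial[of "harm (Suc n)" m "inverse (of_nat (Suc n)) :: complex"]
      by (simp add: harm_Suc del: of_nat_Suc)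
    ultimately show "(\<Sum>k = 1..m. of_nat (m choose k) * (-1) ^ (k + 1) * ((-1) ^ n * harm_term (m - k) (of_nat k) n))
      = (-1) ^ n * (?h (Suc n) - ?h n)"
      by (simp only: sum_distrib_left mult.assoc mult.left_commute)
  qed
  finally have 2: "2 * euler_value (harm_term m 0) = ?S" by (rule sums_unique2[OF 1])
  have "x = 1 / 2 * y" if "2 * x = y" for x y :: complex
    using that by auto
  from this[OF 2] show ?thesis .
qed

theorem theorem7:
  fixes m :: nat
  assumes "m \<ge> 1"
  shows "harm_eta_regularized_at_0 m
           (1 / 2 * (\<Sum>k = 1..m. of_nat (m choose k) * (-1) ^ (k + 1) * harm_eta (m - k) (of_nat k)))"
  \<comment> \<open>Once the value is rewritten as \<open>euler_value (harm_term m 0)\<close>, the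
    continuation takes it at 0 by its very form.\<close>
  unfolding harm_eta_regularized_at_0_def euler_value_harm_0[OF assms, symmetric]
  using harm_eta_abel_tendsto holomorphic_euler_value_harm harm_term_sums(2)
  by (intro conjI exI[of _ "\<lambda>s. euler_value (harm_term m s)"]) auto

end
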